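(* Let $(\Omega,d,\mu)$ be a metric measure space, let $0<p<\infty$, set $p_0:=\min\{1,p\}$, and let $v\in\mathcal A_0$ be strictly increasing. (i) Assume that there exists a constant $C>0$ such that, for every $f\in L^{p_0}(\mu)+L^\infty(\mu)$ and every $t>0$, $$O(|f|^{p_0},t)^{1/p_0}\le C\Big(\big([\nabla^p_{v^{-1}(t)}f]^p\big)^{**}(t)\Big)^{1/p}.$$ Then there exists a constant $K>0$ such that $\inf_{x\in\Omega}\mu(B(x,R))\ge K\,v(R)$ for all $R>0$. (ii) Let $\phi\in\mathcal A_0$ be strictly increasing and concave. Assume that there exists a constant $C>0$ such that, for every $f\in L^{p_0}(\mu)+L^\infty(\mu)$, every $g\in D^\phi(f)$, and every $t>0$, $$O(|f|^{p_0},t)^{1/p_0}\le C\,\phi(v^{-1}(t))\big((g^p)^{**}(t)\big)^{1/p}.$$ Then there exists a constant $K_0>0$ such that $\inf_{x\in\Omega}\mu(B(x,R))\ge K_0\,v(R)$ for all $R>0$.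
   Context: Metric measure space: $(\Omega,d)$ is a separable metric space, $\mu$ is a nonatomic Borel measure on $\Omega$ (in particular $\mu(\{x\})=0$ for all $x$) with $\mu(\Omega)=\infty$ and $0<\mu(B)<\infty$ for every open ball $B=B(x,r)=\{y:d(x,y)<r\}$. Rearrangements: for measurable $f$, $f^*(t)=\inf\{\lambda\ge0:\mu\{|f|>\lambda\}\le t\}$, $f^{**}(t)=\frac1t\int_0^tf^*(s)\,ds$, and the oscillation functional is $O(f,t)=f^{**}(t)-f^*(t)$, $t>0$. Averaged modulus: $\nabla_r^pf(x)=\Big(\frac1{\mu(B(x,r))}\int_{B(x,r)}|f(x)-f(y)|^p\,d\mu(y)\Big)^{1/p}$ (possibly $+\infty$). Haj\l asz gradients: $D^\phi(f)$ is the set of nonnegative measurable $g$ with $|f(x)-f(y)|\le\phi(d(x,y))(g(x)+g(y))$ for $\mu$-a.e. $x,y\in\Omega$. Class $\mathcal A_0$: continuous increasing functions $\phi:[0,\infty)\to[0,\infty)$ with $\phi(0)=0$, $\phi(t)>0$ for $t>0$, $M_\phi(\lambda):=\sup_{s>0}\phi(\lambda s)/\phi(s)<\infty$ for every $\lambda>0$, and $0<\underline\beta_\phi\le\overline\beta_\phi<\infty$, where $\underline\beta_\phi=\lim_{\lambda\to0^+}\frac{\log M_\phi(\lambda)}{\log\lambda}$ and $\overline\beta_\phi=\lim_{\lambda\to\infty}\frac{\log M_\phi(\lambda)}{\log\lambda}$. Functions in $\mathcal A_0$ are considered up to equivalence, and strictly increasing representatives are chosen whenever inverses are used. *)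

theory Defs
  imports "HOL-Analysis.Analysis"
begin

definition nonatomic :: "'a measure \<Rightarrow> bool" where
  "nonatomic M \<longleftrightarrow>
     (\<forall>A\<in>sets M. emeasure M A > 0 \<longrightarrow>
        (\<exists>B\<in>sets M. B \<subseteq> A \<and> 0 < emeasure M B \<and> emeasure M B < emeasure M A))"

definition metric_measure_space :: "('a::metric_space) measure \<Rightarrow> bool" where
  "metric_measure_space M \<longleftrightarrow>
     separable_space (euclidean :: 'a topology) \<and>
     sets M = sets borel \<and>
     nonatomic M \<and>
     emeasure M UNIV = \<infinity> \<and>
     (\<forall>x r. 0 < r \<longrightarrow> 0 < emeasure M (ball x r) \<and> emeasure M (ball x r) < \<infinity>)"

text \<open>Powers of extended nonnegative numbers; only used with exponent \<open>a > 0\<close>, where the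
  value at infinity is infinity.\<close>

definition epowr :: "ennreal \<Rightarrow> real \<Rightarrow> ennreal" where
  "epowr x a = (if x = \<infinity> then \<infinity> else ennreal (enn2real x powr a))"

text \<open>The rearrangement is defined for functions with values in \<open>[0, \<infinity>]\<close>, because the averaged
  modulus below may be infinite; for a real function \<open>f\<close> it is to be applied to \<open>\<bar>f\<bar>\<close>.
  The infimum of the empty set is infinity.\<close>

definition rearr :: "'a measure \<Rightarrow> ('a \<Rightarrow> ennreal) \<Rightarrow> real \<Rightarrow> ennreal" where
  "rearr M h t =
     Inf {ennreal l | l. 0 \<le> l \<and> emeasure M {x \<in> space M. h x > ennreal l} \<le> ennreal t}"

definition rearr_avg :: "'a measure \<Rightarrow> ('a \<Rightarrow> ennreal) \<Rightarrow> real \<Rightarrow> ennreal" where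
  "rearr_avg M h t = (\<integral>\<^sup>+s\<in>{0<..<t}. rearr M h s \<partial>lborel) / ennreal t"

definition osc :: "'a measure \<Rightarrow> ('a \<Rightarrow> ennreal) \<Rightarrow> real \<Rightarrow> ennreal" where
  "osc M h t = rearr_avg M h t - rearr M h t"

definition avg_modulus ::
    "('a::metric_space) measure \<Rightarrow> real \<Rightarrow> real \<Rightarrow> ('a \<Rightarrow> real) \<Rightarrow> 'a \<Rightarrow> ennreal" where
  "avg_modulus M p r f x =
     epowr ((\<integral>\<^sup>+y\<in>ball x r. ennreal (\<bar>f x - f y\<bar> powr p) \<partial>M) / emeasure M (ball x r)) (1 / p)"

definition Lq_plus_Linf :: "'a measure \<Rightarrow> real \<Rightarrow> ('a \<Rightarrow> real) set" where
  "Lq_plus_Linf M q =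
     {f \<in> borel_measurable M.
        \<exists>a\<in>borel_measurable M. \<exists>b\<in>borel_measurable M.
          (\<forall>x\<in>space M. f x = a x + b x) \<and>
          (\<integral>\<^sup>+x. ennreal (\<bar>a x\<bar> powr q) \<partial>M) < \<infinity> \<and>
          (\<exists>K. AE x in M. \<bar>b x\<bar> \<le> K)}"

text \<open>``For almost every \<open>x, y\<close>'' means: for all \<open>x, y\<close> outside one exceptional null set.\<close>

definition hajlasz_gradients ::
    "('a::metric_space) measure \<Rightarrow> (real \<Rightarrow> real) \<Rightarrow> ('a \<Rightarrow> real) \<Rightarrow> ('a \<Rightarrow> real) set" where
  "hajlasz_gradients M \<phi> f =
     {g \<in> borel_measurable M. (\<forall>x\<in>space M. 0 \<le> g x) \<and>
        (\<exists>N\<in>null_sets M. \<forall>x\<in>space M - N. \<forall>y\<in>space M - N.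
           \<bar>f x - f y\<bar> \<le> \<phi> (dist x y) * (g x + g y))}"

definition dilation :: "(real \<Rightarrow> real) \<Rightarrow> real \<Rightarrow> real" where
  "dilation \<phi> l = (SUP s\<in>{0<..}. \<phi> (l * s) / \<phi> s)"

text \<open>Functions on \<open>[0, \<infinity>)\<close> are represented by functions on the reals, whose values at negative
  arguments are irrelevant. Finiteness of the dilation function is the boundedness condition,
  under which the real supremum above is meaningful. The numbers \<open>a\<close> and \<open>b\<close> are the lower and
  upper indices; as real limits they are automatically finite.\<close>

definition class_A0 :: "(real \<Rightarrow> real) \<Rightarrow> bool" where
  "class_A0 \<phi> \<longleftrightarrow>
     continuous_on {0..} \<phi> \<and> mono_on {0..} \<phi> \<and> \<phi> 0 = 0 \<and> (\<forall>t>0. 0 < \<phi> t) \<and>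
     (\<forall>l>0. bdd_above ((\<lambda>s. \<phi> (l * s) / \<phi> s) ` {0<..})) \<and>
     (\<exists>a b. ((\<lambda>l. ln (dilation \<phi> l) / ln l) \<longlongrightarrow> a) (at_right 0) \<and>
            ((\<lambda>l. ln (dilation \<phi> l) / ln l) \<longlongrightarrow> b) at_top \<and>
            0 < a \<and> a \<le> b)"

end

theory Submission
  imports Defs
begin

text \<open>The hypotheses are tested on the bump \<open>f(y) = (\<phi>(R) - \<phi>(d(x,y)))\<^sub>+\<close>, with \<open>\<phi>(s) = s\<close> in part (i).
  Subadditivity of \<open>\<phi>\<close> makes the constant \<open>1\<close> a gradient (respectively \<open>r\<close> a bound for the averaged
  modulus at radius \<open>r\<close>), so the oscillation at \<open>t\<close> of the \<open>p\<^sub>0\<close>-th power of \<open>f\<close> is at most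
  \<open>W(t) = (C \<phi>(v\<^sup>-\<^sup>1(t))) powr p\<^sub>0\<close>. No doubling is needed: \<open>W\<close> decays geometrically along \<open>m / A^n\<close>
  for a suitable \<open>A\<close>, because \<open>\<phi>\<close> has positive lower index and \<open>v\<close> finite dilations, and summing
  the oscillations from \<open>m = \<mu>(B(x,R))\<close>, where the rearrangement vanishes, down to \<open>0\<close> bounds the
  maximum of \<open>f\<close>. This gives \<open>\<phi>(R) \<le> B \<phi>(v\<^sup>-\<^sup>1(m))\<close>, hence \<open>v\<^sup>-\<^sup>1(m) \<ge> j R\<close> and \<open>m \<ge> v(R) / D\<close>, with
  constants \<open>B, j, D\<close> independent of \<open>x\<close> and \<open>R\<close>.\<close>

section \<open>Powers, rearrangements and their averages\<close>

lemma epowr_le_ennreal_iff: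
  assumes "0 < q" "0 \<le> c"
  shows "epowr x (1 / q) \<le> ennreal c \<longleftrightarrow> x \<le> ennreal (c powr q)"
proof (cases x)
  case (real u)
  have "u powr (1 / q) \<le> c \<longleftrightarrow> (u powr (1 / q)) powr q \<le> c powr q"
    using assms by (meson powr_le_cancel_iff powr_mono2 powr_ge_zero not_le powr_less_mono2 less_imp_le)
  also have "\<dots> \<longleftrightarrow> u \<le> c powr q"
    using assms real by (simp add: powr_powr)
  finally show ?thesis
    using assms real by (simp add: epowr_def)
qed (simp_all add: epowr_def top_unique)

lemma rearr_antimono:
  assumes "s \<le> t"
  shows "rearr M h t \<le> rearr M h s"
  unfolding rearr_def
  by (rule Inf_superset_mono) (use assms ennreal_leI order_trans in fastforce)

lemma rearr_le:
  assumes "0 \<le> c" "emeasure M {x \<in> space M. h x > ennreal c} \<le> ennreal t"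
  shows "rearr M h t \<le> ennreal c"
  unfolding rearr_def using assms by (intro Inf_lower) auto

lemma rearr_le_bound:
  assumes "0 \<le> c" "\<And>x. x \<in> space M \<Longrightarrow> h x \<le> ennreal c"
  shows "rearr M h t \<le> ennreal c"
proof (rule rearr_le)
  have "{x \<in> space M. h x > ennreal c} = {}"
    using assms(2) by (auto simp: not_less)
  then show "emeasure M {x \<in> space M. h x > ennreal c} \<le> ennreal t"
    by (simp only: emeasure_empty zero_le)
qed (use assms in auto)

text \<open>For \<open>l\<close> below \<open>c\<close> the set where \<open>h\<close> exceeds
  \<open>l\<close> contains the level set at \<open>c\<close>, so its measure exceeds
  \<open>t\<close> and \<open>l\<close> does not compete in the infimum.\<close>

lemma rearr_ge:
  assumes "h \<in> borel_measurable M" and "ennreal t < emeasure M {x \<in> space M. ennreal c \<le> h x}"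
  shows "ennreal c \<le> rearr M h t"
  unfolding rearr_def
proof (rule Inf_greatest, clarify)
  fix l :: real
  assume l: "0 \<le> l" "emeasure M {x \<in> space M. ennreal l < h x} \<le> ennreal t"
  show "ennreal c \<le> ennreal l"
  proof (rule ccontr)
    assume "\<not> ennreal c \<le> ennreal l"
    then have "emeasure M {x \<in> space M. ennreal c \<le> h x}
        \<le> emeasure M {x \<in> space M. ennreal l < h x}"
      using assms(1) by (intro emeasure_mono) auto
    with l assms(2) show False by auto
  qed
qed

lemma borel_measurable_antimono_ennreal:
  fixes g :: "real \<Rightarrow> ennreal"
  assumes "\<And>s t. s \<le> t \<Longrightarrow> g t \<le> g s"
  shows "g \<in> borel_measurable borel"
proof (rule borel_measurableI_greater)
  fix c
  \<comment> \<open>Superlevel sets of a decreasing function are downward closed, hence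
    intervals.\<close>
  have "is_interval {s. c < g s}"
    unfolding is_interval_1 using assms by (auto intro: less_le_trans)
  then show "{x \<in> space borel. c < g x} \<in> sets borel"
    by (simp add: real_interval_borel_measurable)
qed

lemma rearr_measurable [measurable]: "rearr M h \<in> borel_measurable borel"
  by (rule borel_measurable_antimono_ennreal) (rule rearr_antimono)

text \<open>On \<open>(s, t)\<close> the decreasing rearrangement stays above its value at
  \<open>t\<close>. Leaving out the point \<open>s\<close> keeps the two indicators disjoint and is
  harmless in a lower bound.\<close>

lemma nn_integral_rearr_ge:
  assumes "0 \<le> s" "s \<le> t"
  shows "(\<integral>\<^sup>+u\<in>{0<..<s}. rearr M h u \<partial>lborel) + ennreal (t - s) * rearr M h t
    \<le> (\<integral>\<^sup>+u\<in>{0<..<t}. rearr M h u \<partial>lborel)"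
proof -
  have "ennreal (t - s) * rearr M h t
      = (\<integral>\<^sup>+u. rearr M h t * indicator {s<..<t} u \<partial>lborel)"
    using assms by (simp add: nn_integral_cmult_indicator mult.commute)
  then have "(\<integral>\<^sup>+u\<in>{0<..<s}. rearr M h u \<partial>lborel) + ennreal (t - s) * rearr M h t
      = (\<integral>\<^sup>+u. rearr M h u * indicator {0<..<s} u
          + rearr M h t * indicator {s<..<t} u \<partial>lborel)"
    by (subst nn_integral_add) simp_all
  also have "\<dots> \<le> (\<integral>\<^sup>+u\<in>{0<..<t}. rearr M h u \<partial>lborel)"
    using assms by (intro nn_integral_mono) (auto simp: indicator_def intro: rearr_antimono)
  finally show ?thesis .
qed

lemma rearr_le_rearr_avg:
  assumes "0 < t"
  shows "rearr M h t \<le> rearr_avg M h t"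
proof -
  have "rearr M h t * ennreal t / ennreal t \<le> rearr_avg M h t"
    unfolding rearr_avg_def using nn_integral_rearr_ge[of 0 t M h] assms
    by (intro divide_right_mono_ennreal) (simp add: mult.commute)
  moreover have "rearr M h t * ennreal t / ennreal t = rearr M h t"
    using assms by (simp add: ennreal_mult_divide_eq)
  ultimately show ?thesis by simp
qed

lemma rearr_avg_le_bound:
  assumes "0 \<le> c" "0 < t" "\<And>x. x \<in> space M \<Longrightarrow> h x \<le> ennreal c"
  shows "rearr_avg M h t \<le> ennreal c"
proof -
  have "(\<integral>\<^sup>+u\<in>{0<..<t}. rearr M h u \<partial>lborel)
      \<le> (\<integral>\<^sup>+u. ennreal c * indicator {0<..<t} u \<partial>lborel)"
    using rearr_le_bound[of c M h] assms
    by (intro nn_integral_mono) (auto simp: indicator_def)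
  also have "\<dots> = ennreal c * ennreal t"
    using assms by (simp add: nn_integral_cmult_indicator)
  finally have "rearr_avg M h t \<le> ennreal c * ennreal t / ennreal t"
    unfolding rearr_avg_def by (rule divide_right_mono_ennreal)
  also have "\<dots> = ennreal c"
    using assms by (simp add: ennreal_mult_divide_eq)
  finally show ?thesis .
qed

section \<open>Summing oscillations along a geometric sequence\<close>

text \<open>Discrete form of the identity \<open>d/dt f**(t) = - O(f,t) / t\<close>.\<close>

lemma rearr_avg_divide_le:
  assumes "1 \<le> A" "0 < t" "rearr M h t < \<infinity>"
  shows "rearr_avg M h (t / A) \<le> rearr_avg M h t + ennreal (A - 1) * osc M h t"
proof -
  define F where "F u = (\<integral>\<^sup>+s\<in>{0<..<u}. rearr M h s \<partial>lborel)" for u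
  let ?r = "rearr M h t" and ?a = "rearr_avg M h t"
  have avg: "rearr_avg M h u = ennreal (1 / u) * F u" if "0 < u" for u
    using that by (simp add: rearr_avg_def F_def divide_ennreal_def inverse_ennreal
        mult.commute inverse_eq_divide)
  have "F (t / A) + ennreal (t - t / A) * ?r \<le> F t"
    unfolding F_def using assms by (intro nn_integral_rearr_ge) (auto simp: field_simps)
  \<comment> \<open>The factor \<open>A / t\<close> normalises the integral up to
    \<open>t / A\<close> into an average and turns the tail into \<open>A - 1\<close> times the
    rearrangement at \<open>t\<close>.\<close>
  then have "ennreal (A / t) * (F (t / A) + ennreal (t - t / A) * ?r) \<le> ennreal (A / t) * F t"
    by (rule mult_left_mono) simp
  moreover have "ennreal (A / t) * F (t / A) = rearr_avg M h (t / A)"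
    using assms by (simp add: avg)
  moreover have "ennreal (A / t) * (ennreal (t - t / A) * ?r) = ennreal (A - 1) * ?r"
  proof -
    have "A / t * (t - t / A) = A - 1" using assms by (simp add: right_diff_distrib)
    moreover have "0 \<le> A / t" "0 \<le> t - t / A" using assms by (auto simp: field_simps)
    ultimately have "ennreal (A / t) * ennreal (t - t / A) = ennreal (A - 1)"
      by (metis ennreal_mult)
    then show ?thesis by (simp only: mult.assoc[symmetric])
  qed
  moreover have "ennreal (A / t) * F t = ennreal A * ?a"
    unfolding avg[OF assms(2)] using assms
    by (subst mult.assoc[symmetric], subst ennreal_mult[symmetric]) simp_all
  moreover have "ennreal A * ?a = ?a + ennreal (A - 1) * ?a"
    using assms ennreal_plus[of 1 "A - 1"] by (simp add: distrib_right)
  ultimately have "rearr_avg M h (t / A) + ennreal (A - 1) * ?r \<le> ?a + ennreal (A - 1) * ?a"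
    by (simp add: distrib_left)
  \<comment> \<open>The truncated subtraction in \<open>osc\<close> loses nothing, since the
    rearrangement is at most its average.\<close>
  also have "\<dots> \<le> ?a + ennreal (A - 1) * (osc M h t + ?r)"
    unfolding osc_def by (intro add_left_mono mult_left_mono)
      (simp_all add: diff_add_cancel_ennreal rearr_le_rearr_avg assms)
  finally have "ennreal (A - 1) * ?r + rearr_avg M h (t / A)
      \<le> ennreal (A - 1) * ?r + (?a + ennreal (A - 1) * osc M h t)"
    by (simp add: distrib_left ac_simps)
  \<comment> \<open>Cancelling the common summand in \<open>ennreal\<close> requires it to be
    finite.\<close>
  moreover have "ennreal (A - 1) * ?r \<noteq> \<infinity>"
    using assms by (simp add: ennreal_mult_eq_top_iff)
  ultimately show ?thesis
    by (simp add: ennreal_add_left_cancel_le)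
qed

text \<open>Each division by \<open>A\<close> adds at most \<open>(A - 1) * W (m / A ^ n)\<close>,
  and halving bounds this by \<open>(A - 1) * (1 / 2) ^ n * W m\<close>. The geometric sum gives the
  factor \<open>2 * (1 - (1 / 2) ^ n)\<close>. The initial \<open>1\<close> is the case
  \<open>n = 0\<close>: the rearrangement vanishes at \<open>m\<close>, so the average there equals
  the oscillation.\<close>

lemma rearr_avg_power_le:
  assumes "1 \<le> A" "0 < m" "\<And>t. 0 < t \<Longrightarrow> rearr M h t < \<infinity>" "rearr M h m = 0"
    and W: "\<And>t. 0 < t \<Longrightarrow> osc M h t \<le> ennreal (W t)" "\<And>t. 0 < t \<Longrightarrow> 0 \<le> W t"
      "\<And>t. 0 < t \<Longrightarrow> W (t / A) \<le> W t / 2"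
  shows "rearr_avg M h (m / A ^ n) \<le> ennreal ((1 + 2 * (A - 1) * (1 - (1 / 2) ^ n)) * W m)"
proof (induction n)
  case 0
  show ?case using W(1)[of m] assms by (simp add: osc_def)
next
  case (Suc n)
  have pos: "0 < m / A ^ n" for n using assms by simp
  have half: "W (m / A ^ n) \<le> (1 / 2) ^ n * W m" for n
  proof (induction n)
    case (Suc n)
    have "W (m / A ^ Suc n) \<le> W (m / A ^ n) / 2"
      using W(3)[OF pos[of n]] by (simp add: mult.commute)
    with Suc show ?case by simp
  qed simp
  have "rearr_avg M h (m / A ^ Suc n) = rearr_avg M h (m / A ^ n / A)"
    by (simp add: mult.commute)
  also have "\<dots> \<le> rearr_avg M h (m / A ^ n) + ennreal (A - 1) * osc M h (m / A ^ n)"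
    using assms pos by (intro rearr_avg_divide_le) auto
  also have "\<dots> \<le> ennreal ((1 + 2 * (A - 1) * (1 - (1 / 2) ^ n)) * W m)
      + ennreal (A - 1) * ennreal ((1 / 2) ^ n * W m)"
    using Suc W(1)[OF pos[of n]] half[of n]
    by (intro add_mono mult_left_mono) (auto intro: order_trans ennreal_leI)
  also have "\<dots> = ennreal ((1 + 2 * (A - 1) * (1 - (1 / 2) ^ n)) * W m
      + (A - 1) * ((1 / 2) ^ n * W m))"
    using assms by (simp add: ennreal_mult[symmetric] ennreal_plus[symmetric] power_le_one
        del: ennreal_plus)
  also have "(1 + 2 * (A - 1) * (1 - (1 / 2) ^ n)) * W m + (A - 1) * ((1 / 2) ^ n * W m)
      = (1 + 2 * (A - 1) * (1 - (1 / 2) ^ Suc n)) * W m"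
    unfolding power_Suc by algebra
  finally show ?case .
qed

text \<open>Once \<open>m / A ^ n\<close> is below the measure of the level set, the rearrangement
  there is at least \<open>c\<close>, while the bound on its average is uniform in \<open>n\<close>.
  How large \<open>n\<close> must be therefore does not affect the constant.\<close>

lemma level_le_oscillation_bound:
  assumes h: "h \<in> borel_measurable M" "0 \<le> H" "\<And>x. x \<in> space M \<Longrightarrow> h x \<le> ennreal H"
    and supp: "0 < m" "emeasure M {x \<in> space M. h x > 0} \<le> ennreal m"
    and A: "1 < A"
    and W: "\<And>t. 0 < t \<Longrightarrow> osc M h t \<le> ennreal (W t)" "\<And>t. 0 < t \<Longrightarrow> 0 \<le> W t"
      "\<And>t. 0 < t \<Longrightarrow> W (t / A) \<le> W t / 2"
    and c: "0 < emeasure M {x \<in> space M. ennreal c \<le> h x}"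
  shows "c \<le> 2 * A * W m"
proof -
  \<comment> \<open>Density of the order gives a finite positive \<open>d\<close>, even if the level
    set has infinite measure.\<close>
  obtain d where d: "0 < d" "ennreal d < emeasure M {x \<in> space M. ennreal c \<le> h x}"
  proof -
    obtain e where e: "0 < e" "e < emeasure M {x \<in> space M. ennreal c \<le> h x}"
      using dense[OF c] by blast
    then have "e < top" by (meson less_le_trans top_greatest)
    then have "e = ennreal (enn2real e)" by simp
    with e that[of "enn2real e"] show ?thesis by (metis ennreal_less_zero_iff)
  qed
  obtain n where "m / d < A ^ n"
    using real_arch_pow[OF A] by blast
  then have n: "m / A ^ n < d" and pos: "0 < m / A ^ n"
    using d supp A by (auto simp: field_simps)
  have fin: "rearr M h t < \<infinity>" for t
    using le_less_trans[OF rearr_le_bound[OF h(2,3)] ennreal_less_top] by simp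
  have zero: "rearr M h m = 0"
    using rearr_le[of 0 M h m] supp by simp
  have "ennreal c \<le> rearr M h (m / A ^ n)"
    by (rule rearr_ge[OF h(1)]) (rule le_less_trans[OF ennreal_leI d(2)], use n in simp)
  also have "\<dots> \<le> rearr_avg M h (m / A ^ n)"
    by (rule rearr_le_rearr_avg[OF pos])
  also have "\<dots> \<le> ennreal ((1 + 2 * (A - 1) * (1 - (1 / 2) ^ n)) * W m)"
    using A supp fin zero W by (intro rearr_avg_power_le) auto
  also have "\<dots> \<le> ennreal (2 * A * W m)"
  proof (intro ennreal_leI mult_right_mono)
    have "2 * (A - 1) * (1 - (1 / 2) ^ n) \<le> 2 * (A - 1) * 1"
      using A by (intro mult_left_mono) auto
    then show "1 + 2 * (A - 1) * (1 - (1 / 2) ^ n) \<le> 2 * A" by simp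
  qed (use W supp in auto)
  finally show ?thesis
    using A W(2)[OF supp(1)] by simp
qed

section \<open>Dilations and inverses in the class \<open>class_A0\<close>\<close>

lemma class_A0_dilation:
  assumes "class_A0 \<phi>" "0 < l" "0 < s"
  shows "\<phi> (l * s) \<le> dilation \<phi> l * \<phi> s" and "0 < dilation \<phi> l"
proof -
  have pos: "\<And>t. 0 < t \<Longrightarrow> 0 < \<phi> t" and bdd: "bdd_above ((\<lambda>s. \<phi> (l * s) / \<phi> s) ` {0<..})"
    using assms by (auto simp: class_A0_def)
  have *: "\<phi> (l * s) / \<phi> s \<le> dilation \<phi> l"
    unfolding dilation_def using bdd assms by (intro cSUP_upper) auto
  then show "\<phi> (l * s) \<le> dilation \<phi> l * \<phi> s"
    using pos[OF assms(3)] by (simp add: field_simps)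
  show "0 < dilation \<phi> l"
    using * pos assms by (meson divide_pos_pos less_le_trans mult_pos_pos)
qed

text \<open>A positive lower index \<open>a\<close> forces the dilation function below
  \<open>l powr (a / 2)\<close> near zero, and this is less than \<open>e\<close> as soon as
  \<open>l < e powr (2 / a)\<close>.\<close>

lemma class_A0_small:
  assumes "class_A0 \<phi>" "0 < e"
  obtains l where "0 < l" "l < 1" "\<And>s. 0 < s \<Longrightarrow> \<phi> (l * s) \<le> e * \<phi> s"
proof -
  obtain a where a: "0 < a" "((\<lambda>l. ln (dilation \<phi> l) / ln l) \<longlongrightarrow> a) (at_right 0)"
    using assms by (auto simp: class_A0_def)
  have 1: "\<forall>\<^sub>F l in at_right 0. a / 2 < ln (dilation \<phi> l) / ln l"
    using a by (intro order_tendstoD) auto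
  have 2: "\<forall>\<^sub>F l in at_right 0. l < min 1 (e powr (2 / a))" "\<forall>\<^sub>F l in at_right (0::real). 0 < l"
    using assms by (auto simp: eventually_at_right_less eventually_at_right_field intro: exI[of _ "min 1 (e powr (2 / a))"])
  obtain l where l: "a / 2 < ln (dilation \<phi> l) / ln l" "l < min 1 (e powr (2 / a))" "0 < l"
    using eventually_happens[OF eventually_conj[OF 1 eventually_conj[OF 2]]] by auto
  have D: "0 < dilation \<phi> l"
    using class_A0_dilation(2)[OF assms(1) l(3), of 1] by simp
  \<comment> \<open>The inequality reverses because \<open>ln l\<close> is negative.\<close>
  have "ln (dilation \<phi> l) < a / 2 * ln l"
    using l by (simp add: less_divide_eq split: if_splits)
  also have "\<dots> < a / 2 * ln (e powr (2 / a))"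
    using l a assms ln_less_cancel_iff[of l "e powr (2 / a)"]
    by (intro mult_strict_left_mono) simp_all
  also have "\<dots> = ln e" using a assms by (simp add: ln_powr)
  finally have De: "dilation \<phi> l \<le> e" using D assms by simp
  show thesis
  proof (rule that)
    fix s :: real assume s: "0 < s"
    have "\<phi> (l * s) \<le> dilation \<phi> l * \<phi> s"
      by (rule class_A0_dilation(1)[OF assms(1) l(3) s])
    also have "\<dots> \<le> e * \<phi> s"
      using De assms s by (intro mult_right_mono) (auto simp: class_A0_def less_imp_le)
    finally show "\<phi> (l * s) \<le> e * \<phi> s" .
  qed (use l in auto)
qed

text \<open>The issue is surjectivity. Smallness with factor \<open>v 1 / t\<close>, read at
  \<open>s = 1 / l\<close>, gives \<open>v (1 / l) \<ge> t\<close>, and the intermediate value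
  theorem then produces a preimage.\<close>

lemma class_A0_the_inv_into:
  assumes "class_A0 v" "strict_mono_on {0..} v" "0 < t"
  shows "0 < the_inv_into {0..} v t" "v (the_inv_into {0..} v t) = t"
proof -
  have v1: "0 < v 1" and v0: "v 0 = 0" using assms by (auto simp: class_A0_def)
  obtain l where l: "0 < l" "l < 1" "\<And>s. 0 < s \<Longrightarrow> v (l * s) \<le> v 1 / t * v s"
    using class_A0_small[OF assms(1), of "v 1 / t"] v1 assms by auto
  have "v 1 \<le> v 1 / t * v (1 / l)" using l(3)[of "1 / l"] l by simp
  then have "t \<le> v (1 / l)" using v1 assms by (simp add: field_simps)
  moreover have "continuous_on {0..1 / l} v"
    using assms(1) by (auto simp: class_A0_def intro: continuous_on_subset)
  ultimately obtain s where s: "0 \<le> s" "v s = t"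
    using IVT'[of v 0 t "1 / l"] assms l v0 by auto
  have "the_inv_into {0..} v t = s"
    using the_inv_into_f_f[OF strict_mono_on_imp_inj_on[OF assms(2)], of s] s by simp
  then show "0 < the_inv_into {0..} v t" "v (the_inv_into {0..} v t) = t"
    using s v0 assms by (auto simp: less_le)
qed

section \<open>Bump functions\<close>

definition bump :: "(real \<Rightarrow> real) \<Rightarrow> 'a::metric_space \<Rightarrow> real \<Rightarrow> 'a \<Rightarrow> real" where
  "bump \<phi> x R y = max 0 (\<phi> R - \<phi> (dist x y))"

lemma bump_measurable:
  assumes "continuous_on {0..} \<phi>"
  shows "bump \<phi> x R \<in> borel_measurable borel"
  unfolding bump_def
  by (intro borel_measurable_continuous_onI continuous_intros continuous_on_compose2[OF assms]) auto

lemma bump_le: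
  assumes "mono_on {0..} \<phi>" "\<phi> 0 = 0" "0 \<le> R"
  shows "bump \<phi> x R y \<le> \<phi> R"
  using mono_onD[OF assms(1), of 0 "dist x y"] mono_onD[OF assms(1), of 0 R] assms
  by (simp add: bump_def)

lemma bump_Lq_plus_Linf:
  assumes "sets M = sets borel" "continuous_on {0..} \<phi>" "mono_on {0..} \<phi>" "\<phi> 0 = 0" "0 \<le> R"
    "0 < q"
  shows "bump \<phi> x R \<in> Lq_plus_Linf M q"
proof -
  have m: "bump \<phi> x R \<in> borel_measurable M"
    using bump_measurable[OF assms(2)] assms(1) measurable_cong_sets by blast
  have "AE y in M. \<bar>bump \<phi> x R y\<bar> \<le> \<phi> R"
    using bump_le[OF assms(3-5), of x] by (simp add: bump_def abs_of_nonneg)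
  with m show ?thesis
    unfolding Lq_plus_Linf_def
    \<comment> \<open>The bump is bounded, so it goes entirely into the bounded summand.\<close>
    by (intro CollectI conjI bexI[of _ "\<lambda>_. 0"] bexI[of _ "bump \<phi> x R"]) (auto simp: assms)
qed

text \<open>Monotonicity and subadditivity turn \<open>\<phi>\<close> of the distance into a
  quantity obeying the triangle inequality, and truncation at zero does not increase
  differences.\<close>

lemma abs_bump_diff_le:
  assumes "mono_on {0..} \<phi>" "\<And>s t. 0 \<le> s \<Longrightarrow> 0 \<le> t \<Longrightarrow> \<phi> (s + t) \<le> \<phi> s + \<phi> t"
  shows "\<bar>bump \<phi> x R y - bump \<phi> x R z\<bar> \<le> \<phi> (dist y z)"
proof -
  have *: "\<phi> (dist x y) \<le> \<phi> (dist x z) + \<phi> (dist y z)" for y z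
  proof -
    have "\<phi> (dist x y) \<le> \<phi> (dist x z + dist y z)"
      by (rule mono_onD[OF assms(1)]) (auto simp: dist_triangle2)
    with assms(2)[of "dist x z" "dist y z"] show ?thesis by simp
  qed
  show ?thesis
    using *[of y z] *[of z y] unfolding bump_def dist_commute[of z y] by linarith
qed

text \<open>The graph lies above the chord from the origin to the point over \<open>s + t\<close>;
  the chord values at \<open>s\<close> and \<open>t\<close> add up to
  \<open>\<phi> (s + t)\<close>.\<close>

lemma concave_on_imp_subadditive:
  fixes \<phi> :: "real \<Rightarrow> real"
  assumes "concave_on {0..} \<phi>" "\<phi> 0 = 0" "0 \<le> s" "0 \<le> t"
  shows "\<phi> (s + t) \<le> \<phi> s + \<phi> t"
proof (cases "s + t = 0")
  case True
  then show ?thesis using assms by (simp add: add_nonneg_eq_0_iff)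
next
  case False
  have *: "u / (s + t) * \<phi> (s + t) \<le> \<phi> u" if "0 \<le> u" "u \<le> s + t" for u
    using concave_onD[OF assms(1), of "u / (s + t)" 0 "s + t"] False assms that by simp
  have "\<phi> (s + t) = s / (s + t) * \<phi> (s + t) + t / (s + t) * \<phi> (s + t)"
    using False by (simp add: distrib_right[symmetric] add_divide_distrib[symmetric])
  also have "\<dots> \<le> \<phi> s + \<phi> t"
    using *[of s] *[of t] assms by simp
  finally show ?thesis .
qed

section \<open>Lower bound for the measure of balls\<close>

text \<open>Common core of both parts. The lower index of \<open>\<phi>\<close> enters only through
  \<open>small\<close>, which for the identity function of part (i) is immediate, and the
  oscillation estimate is required for bumps alone.\<close>

lemma ball_measure_lower_bound:
  fixes M :: "'a::metric_space measure"
  assumes M: "metric_measure_space M" and q: "0 < q"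
    and v: "class_A0 v" "strict_mono_on {0..} v"
    and \<phi>: "continuous_on {0..} \<phi>" "mono_on {0..} \<phi>" "\<phi> 0 = 0" "\<And>s. 0 < s \<Longrightarrow> 0 < \<phi> s"
    and small: "\<And>e. 0 < e \<Longrightarrow> \<exists>l. 0 < l \<and> l < 1 \<and> (\<forall>s>0. \<phi> (l * s) \<le> e * \<phi> s)"
    and C: "0 < C"
    and bound: "\<And>x R t. 0 < R \<Longrightarrow> 0 < t \<Longrightarrow>
      epowr (osc M (\<lambda>y. ennreal (\<bar>bump \<phi> x R y\<bar> powr q)) t) (1 / q)
        \<le> ennreal (C * \<phi> (the_inv_into {0..} v t))"
  shows "\<exists>K>0. \<forall>R>0. (INF x. emeasure M (ball x R)) \<ge> ennreal (K * v R)"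
proof -
  define w where "w = the_inv_into {0..} v"
  have w: "0 < w t" "v (w t) = t" if "0 < t" for t
    using class_A0_the_inv_into[OF v that] by (auto simp: w_def)
  have v_le: "s \<le> t \<longleftrightarrow> v s \<le> v t" if "0 \<le> s" "0 \<le> t" for s t
    using strict_mono_on_less_eq[OF v(2), of s t] that by simp
  define W where "W t = (C * \<phi> (w t)) powr q" for t
  \<comment> \<open>The contraction factor is chosen so that its \<open>q\<close>-th power is one
    half.\<close>
  have "0 < (1 / 2 :: real) powr (1 / q)" by simp
  then obtain l where l: "0 < l" "l < 1" "\<And>s. 0 < s \<Longrightarrow> \<phi> (l * s) \<le> (1 / 2) powr (1 / q) * \<phi> s"
    using small by blast
  \<comment> \<open>Passing from \<open>t\<close> to \<open>t / A\<close> has to shrink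
    \<open>w t\<close> by at least the factor \<open>l\<close>; dilating \<open>l * w t\<close> back
    by \<open>1 / l\<close> shows that this \<open>A\<close> suffices. The maximum with 2 ensures
    \<open>A > 1\<close>.\<close>
  define A where "A = max 2 (dilation v (1 / l))"
  have A: "1 < A" by (simp add: A_def)
  have W_half: "W (t / A) \<le> W t / 2" if t: "0 < t" for t
  proof -
    have tA: "0 < t / A" using t A by simp
    have "t \<le> dilation v (1 / l) * v (l * w t)"
      using class_A0_dilation(1)[OF v(1), of "1 / l" "l * w t"] l w[OF t] by simp
    also have "\<dots> \<le> A * v (l * w t)"
      using v(1) l w[OF t] by (intro mult_right_mono) (auto simp: A_def class_A0_def less_imp_le)
    finally have "A * v (w (t / A)) \<le> A * v (l * w t)"
      using A w(2)[OF tA] by simp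
    then have "v (w (t / A)) \<le> v (l * w t)"
      using A by simp
    then have "w (t / A) \<le> l * w t"
      using v_le w[OF tA] w[OF t] l by (simp add: less_imp_le)
    then have "\<phi> (w (t / A)) \<le> \<phi> (l * w t)"
      using w[OF tA] w[OF t] l by (intro mono_onD[OF \<phi>(2)]) auto
    also have "\<dots> \<le> (1 / 2) powr (1 / q) * \<phi> (w t)"
      by (rule l(3)[OF w(1)[OF t]])
    finally have "W (t / A) \<le> (C * ((1 / 2) powr (1 / q) * \<phi> (w t))) powr q"
      unfolding W_def using C q \<phi>(4)[OF w(1)[OF tA]] by (intro powr_mono2) auto
    also have "\<dots> = W t / 2"
      unfolding W_def using C q \<phi>(4)[OF w(1)[OF t]] by (simp add: powr_mult powr_powr)
    finally show ?thesis .
  qed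
  \<comment> \<open>On the ball of radius \<open>k * R\<close> the bump keeps at least half of its
    maximum.\<close>
  obtain k where k: "0 < k" "k < 1" "\<And>s. 0 < s \<Longrightarrow> \<phi> (k * s) \<le> 1 / 2 * \<phi> s"
    using small[of "1 / 2"] by auto
  \<comment> \<open>This constant results from the \<open>q\<close>-th root of
    \<open>(\<phi> R / 2) powr q \<le> 2 * A * W m\<close>.\<close>
  define B where "B = 2 * (2 * A) powr (1 / q) * C"
  have B: "0 < B" using A C by (simp add: B_def)
  \<comment> \<open>With this factor, \<open>w m \<le> j * R\<close> would make
    \<open>B * \<phi> (w m)\<close> at most half of \<open>\<phi> R\<close>, contradicting the bound
    by \<open>B\<close>.\<close>
  obtain j where j: "0 < j" "j < 1" "\<And>s. 0 < s \<Longrightarrow> \<phi> (j * s) \<le> 1 / (2 * B) * \<phi> s"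
    using small[of "1 / (2 * B)"] B by auto
  \<comment> \<open>Dilating by \<open>1 / j\<close> converts \<open>v (j * R) \<le> m\<close> into
    \<open>v R \<le> D * m\<close>.\<close>
  define D where "D = dilation v (1 / j)"
  have D: "0 < D" unfolding D_def using class_A0_dilation(2)[OF v(1), of "1 / j" 1] j by simp
  have sp: "space M = UNIV" and sets: "sets M = sets borel"
    using M by (auto simp: metric_measure_space_def dest: sets_eq_imp_space_eq)
  have main: "ennreal (1 / D * v R) \<le> emeasure M (ball x R)" if R: "0 < R" for x R
  proof -
    have ball: "0 < emeasure M (ball x r)" "emeasure M (ball x r) < \<infinity>" if "0 < r" for r
      using M that by (auto simp: metric_measure_space_def)
    define m where "m = measure M (ball x R)"
    have m: "emeasure M (ball x R) = ennreal m"
      unfolding m_def using ball(2)[OF R] by (intro emeasure_eq_ennreal_measure) simp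
    have m_pos: "0 < m"
      using ball(1)[OF R] by (simp add: m)
    define h where "h y = ennreal (\<bar>bump \<phi> x R y\<bar> powr q)" for y
    have hm: "h \<in> borel_measurable M"
    proof -
      have [measurable]: "bump \<phi> x R \<in> borel_measurable M"
        using bump_measurable[OF \<phi>(1)] measurable_cong_sets[OF sets refl] by blast
      show ?thesis unfolding h_def by measurable
    qed
    have "(\<phi> R / 2) powr q \<le> 2 * A * W m"
    proof (rule level_le_oscillation_bound[OF hm _ _ m_pos _ A])
      show "h y \<le> ennreal (\<phi> R powr q)" for y
        unfolding h_def using bump_le[OF \<phi>(2,3), of R x y] R q
        by (intro ennreal_leI powr_mono2) (auto simp: bump_def)
      have "{y \<in> space M. 0 < h y} \<subseteq> ball x R"
      proof clarify
        fix y assume "0 < h y"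
        then have "\<phi> (dist x y) < \<phi> R"
          by (auto simp: h_def bump_def max_def split: if_splits)
        \<comment> \<open>Outside the ball monotonicity would give
          \<open>\<phi> R \<le> \<phi> (dist x y)\<close>.\<close>
        then show "y \<in> ball x R"
          using mono_onD[OF \<phi>(2), of R "dist x y"] R by (force simp: not_less)
      qed
      then have "emeasure M {y \<in> space M. 0 < h y} \<le> emeasure M (ball x R)"
        by (intro emeasure_mono) (simp_all add: sets)
      then show "emeasure M {y \<in> space M. 0 < h y} \<le> ennreal m" using m by simp
      show "osc M h t \<le> ennreal (W t)" if "0 < t" for t
        using bound[OF R that, of x] epowr_le_ennreal_iff[OF q, of "C * \<phi> (w t)"] C \<phi>(4)[OF w(1)[OF that]]
        unfolding W_def h_def w_def by (simp add: less_imp_le)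
      have "ball x (k * R) \<subseteq> {y \<in> space M. ennreal ((\<phi> R / 2) powr q) \<le> h y}"
      proof
        fix y assume "y \<in> ball x (k * R)"
        then have "\<phi> (dist x y) \<le> \<phi> (k * R)"
          using k R by (intro mono_onD[OF \<phi>(2)]) auto
        then have "\<phi> R / 2 \<le> \<bar>bump \<phi> x R y\<bar>"
          using k(3)[OF R] unfolding bump_def by linarith
        then show "y \<in> {y \<in> space M. ennreal ((\<phi> R / 2) powr q) \<le> h y}"
          unfolding h_def using q \<phi>(4)[OF R] by (auto simp: sp intro!: ennreal_leI powr_mono2)
      qed
      then have "emeasure M (ball x (k * R))
          \<le> emeasure M {y \<in> space M. ennreal ((\<phi> R / 2) powr q) \<le> h y}"
        using hm by (intro emeasure_mono) auto
      then show "0 < emeasure M {y \<in> space M. ennreal ((\<phi> R / 2) powr q) \<le> h y}"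
        using ball(1)[of "k * R"] k R by (auto intro: less_le_trans)
      show "0 \<le> W t" for t by (simp add: W_def)
    qed (simp_all add: W_half del: le_divide_eq_numeral1)
    then have "((\<phi> R / 2) powr q) powr (1 / q) \<le> (2 * A * W m) powr (1 / q)"
      using q by (intro powr_mono2) auto
    then have "\<phi> R \<le> B * \<phi> (w m)"
      using q A C \<phi>(4)[OF R] \<phi>(4)[OF w(1)[OF m_pos]]
      by (simp add: powr_powr powr_mult W_def B_def field_simps)
    moreover have "B * \<phi> (w m) < \<phi> R" if "w m \<le> j * R"
    proof -
      have "\<phi> (w m) \<le> \<phi> (j * R)"
        using that w(1)[OF m_pos] by (intro mono_onD[OF \<phi>(2)]) auto
      also have "\<dots> \<le> 1 / (2 * B) * \<phi> R" by (rule j(3)[OF R])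
      finally have "B * \<phi> (w m) \<le> \<phi> R / 2" using B by (simp add: field_simps)
      also have "\<dots> < \<phi> R" using \<phi>(4)[OF R] by simp
      finally show ?thesis .
    qed
    ultimately have "j * R \<le> w m" by linarith
    then have "v (j * R) \<le> m"
      using v_le[of "j * R" "w m"] w[OF m_pos] j R by simp
    moreover have "v R \<le> D * v (j * R)"
      using class_A0_dilation(1)[OF v(1), of "1 / j" "j * R"] j R by (simp add: D_def)
    ultimately have "v R \<le> D * m"
      using D by (meson mult_left_mono less_imp_le order_trans)
    then show ?thesis
      using D m by (simp add: field_simps ennreal_leI)
  qed
  show ?thesis
    using D main by (intro exI[of _ "1 / D"] conjI allI impI INF_greatest) auto
qed

section \<open>Averaged modulus and the two implications\<close>

lemma avg_modulus_le:
  assumes "metric_measure_space M" "0 < p" "0 < r" "\<And>y. dist x y < r \<Longrightarrow> \<bar>f x - f y\<bar> \<le> r"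
  shows "avg_modulus M p r f x \<le> ennreal r"
proof -
  have b: "0 < emeasure M (ball x r)" "emeasure M (ball x r) < \<infinity>" "ball x r \<in> sets M"
    using assms by (auto simp: metric_measure_space_def)
  have "(\<integral>\<^sup>+y\<in>ball x r. ennreal (\<bar>f x - f y\<bar> powr p) \<partial>M)
      \<le> (\<integral>\<^sup>+y. ennreal (r powr p) * indicator (ball x r) y \<partial>M)"
    using assms by (intro nn_integral_mono) (auto simp: indicator_def intro!: ennreal_leI powr_mono2)
  also have "\<dots> = ennreal (r powr p) * emeasure M (ball x r)"
    using b by (simp add: nn_integral_cmult_indicator)
  finally have "(\<integral>\<^sup>+y\<in>ball x r. ennreal (\<bar>f x - f y\<bar> powr p) \<partial>M) / emeasure M (ball x r)
      \<le> ennreal (r powr p) * emeasure M (ball x r) / emeasure M (ball x r)"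
    by (rule divide_right_mono_ennreal)
  also have "\<dots> = ennreal (r powr p)"
    using b by (simp add: ennreal_mult_divide_eq)
  finally show ?thesis
    unfolding avg_modulus_def using epowr_le_ennreal_iff assms by (simp add: less_imp_le)
qed

theorem theorem4:
  fixes M :: "('a::metric_space) measure" and p p0 :: real and v :: "real \<Rightarrow> real"
  assumes "metric_measure_space M"
    and "0 < p"
    and "p0 = min 1 p"
    and "class_A0 v"
    and "strict_mono_on {0..} v"
  shows
    "((\<exists>C>0. \<forall>f\<in>Lq_plus_Linf M p0. \<forall>t>0.
         epowr (osc M (\<lambda>x. ennreal (\<bar>f x\<bar> powr p0)) t) (1 / p0)
           \<le> ennreal C *
             epowr (rearr_avg M (\<lambda>x. epowr (avg_modulus M p (the_inv_into {0..} v t) f x) p) t)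
               (1 / p))
      \<longrightarrow> (\<exists>K>0. \<forall>R>0. (INF x. emeasure M (ball x R)) \<ge> ennreal (K * v R)))
    \<and>
     (\<forall>\<phi> :: real \<Rightarrow> real.
        class_A0 \<phi> \<and> strict_mono_on {0..} \<phi> \<and> concave_on {0..} \<phi> \<and>
        (\<exists>C>0. \<forall>f\<in>Lq_plus_Linf M p0. \<forall>g\<in>hajlasz_gradients M \<phi> f. \<forall>t>0.
           epowr (osc M (\<lambda>x. ennreal (\<bar>f x\<bar> powr p0)) t) (1 / p0)
             \<le> ennreal (C * \<phi> (the_inv_into {0..} v t)) *
               epowr (rearr_avg M (\<lambda>x. ennreal (g x powr p)) t) (1 / p))
        \<longrightarrow> (\<exists>K0>0. \<forall>R>0. (INF x. emeasure M (ball x R)) \<ge> ennreal (K0 * v R)))"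
proof (intro conjI impI allI)
  have p0: "0 < p0" using assms by simp
  have sets: "sets M = sets borel"
    using assms(1) by (simp add: metric_measure_space_def)
  note w = class_A0_the_inv_into[OF assms(4,5)]
  {
    assume "\<exists>C>0. \<forall>f\<in>Lq_plus_Linf M p0. \<forall>t>0.
         epowr (osc M (\<lambda>x. ennreal (\<bar>f x\<bar> powr p0)) t) (1 / p0)
           \<le> ennreal C *
             epowr (rearr_avg M (\<lambda>x. epowr (avg_modulus M p (the_inv_into {0..} v t) f x) p) t)
               (1 / p)"
    then obtain C where C: "0 < C" "\<And>f t. f \<in> Lq_plus_Linf M p0 \<Longrightarrow> 0 < t \<Longrightarrow>
         epowr (osc M (\<lambda>x. ennreal (\<bar>f x\<bar> powr p0)) t) (1 / p0)
           \<le> ennreal C *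
             epowr (rearr_avg M (\<lambda>x. epowr (avg_modulus M p (the_inv_into {0..} v t) f x) p) t)
               (1 / p)"
      by blast
    have id: "mono_on {0..} (\<lambda>s::real. s)" by (auto simp: mono_on_def)
    show "\<exists>K>0. \<forall>R>0. (INF x. emeasure M (ball x R)) \<ge> ennreal (K * v R)"
    \<comment> \<open>Here \<open>\<phi>\<close> is the identity, so the bump is 1-Lipschitz and its
      modulus at radius \<open>r\<close> is at most \<open>r\<close>.\<close>
    proof (rule ball_measure_lower_bound[OF assms(1) p0 assms(4,5) _ id _ _ _ C(1)])
      fix e :: real assume "0 < e"
      then show "\<exists>l. 0 < l \<and> l < 1 \<and> (\<forall>s>0. l * s \<le> e * s)"
        by (intro exI[of _ "min (1 / 2) e"]) auto
    next
      fix x :: 'a and R t :: real assume R: "0 < R" and t: "0 < t"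
      define f where "f = bump (\<lambda>s. s) x R"
      define r where "r = the_inv_into {0..} v t"
      have r: "0 < r" using w[OF t] by (simp add: r_def)
      have "avg_modulus M p r f y \<le> ennreal r" for y
      proof (rule avg_modulus_le[OF assms(1,2) r])
        show "\<bar>f y - f z\<bar> \<le> r" if "dist y z < r" for z
          using abs_bump_diff_le[OF id, of x R y z] that by (simp add: f_def)
      qed
      then have "epowr (avg_modulus M p r f y) p \<le> ennreal (r powr p)" for y
        \<comment> \<open>The root criterion is used with exponent \<open>1 / p\<close>, whose
          reciprocal is the power \<open>p\<close>.\<close>
        using epowr_le_ennreal_iff[of "1 / p" "r powr p"] assms(2) r by (simp add: powr_powr)
      then have "rearr_avg M (\<lambda>y. epowr (avg_modulus M p r f y) p) t \<le> ennreal (r powr p)"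
        using t by (intro rearr_avg_le_bound) auto
      then have "epowr (rearr_avg M (\<lambda>y. epowr (avg_modulus M p r f y) p) t) (1 / p) \<le> ennreal r"
        using epowr_le_ennreal_iff[OF assms(2), of r] r by simp
      then have "ennreal C * epowr (rearr_avg M (\<lambda>y. epowr (avg_modulus M p r f y) p) t) (1 / p)
          \<le> ennreal (C * r)"
        using C(1) r by (simp add: ennreal_mult mult_left_mono)
      moreover have "f \<in> Lq_plus_Linf M p0"
        unfolding f_def using sets id R p0 by (intro bump_Lq_plus_Linf) (auto intro: continuous_on_id)
      ultimately show "epowr (osc M (\<lambda>y. ennreal (\<bar>bump (\<lambda>s. s) x R y\<bar> powr p0)) t) (1 / p0)
          \<le> ennreal (C * the_inv_into {0..} v t)"
        using C(2)[OF _ t, of f] unfolding f_def r_def by (blast intro: order_trans)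
    qed (auto intro: continuous_on_id)
  next
    fix \<phi> :: "real \<Rightarrow> real"
    assume "class_A0 \<phi> \<and> strict_mono_on {0..} \<phi> \<and> concave_on {0..} \<phi> \<and>
        (\<exists>C>0. \<forall>f\<in>Lq_plus_Linf M p0. \<forall>g\<in>hajlasz_gradients M \<phi> f. \<forall>t>0.
           epowr (osc M (\<lambda>x. ennreal (\<bar>f x\<bar> powr p0)) t) (1 / p0)
             \<le> ennreal (C * \<phi> (the_inv_into {0..} v t)) *
               epowr (rearr_avg M (\<lambda>x. ennreal (g x powr p)) t) (1 / p))"
    then obtain C where \<phi>: "class_A0 \<phi>" "concave_on {0..} \<phi>" and C: "0 < C"
      "\<And>f g t. f \<in> Lq_plus_Linf M p0 \<Longrightarrow> g \<in> hajlasz_gradients M \<phi> f \<Longrightarrow> 0 < t \<Longrightarrow>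
           epowr (osc M (\<lambda>x. ennreal (\<bar>f x\<bar> powr p0)) t) (1 / p0)
             \<le> ennreal (C * \<phi> (the_inv_into {0..} v t)) *
               epowr (rearr_avg M (\<lambda>x. ennreal (g x powr p)) t) (1 / p)"
      by blast
    have \<phi>': "continuous_on {0..} \<phi>" "mono_on {0..} \<phi>" "\<phi> 0 = 0" "\<And>s. 0 < s \<Longrightarrow> 0 < \<phi> s"
      using \<phi>(1) by (auto simp: class_A0_def)
    have nonneg: "0 \<le> \<phi> s" if "0 \<le> s" for s
      using mono_onD[OF \<phi>'(2), of 0 s] \<phi>'(3) that by simp
    show "\<exists>K0>0. \<forall>R>0. (INF x. emeasure M (ball x R)) \<ge> ennreal (K0 * v R)"
    proof (rule ball_measure_lower_bound[OF assms(1) p0 assms(4,5) \<phi>' _ C(1)])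
      fix e :: real assume "0 < e"
      then show "\<exists>l. 0 < l \<and> l < 1 \<and> (\<forall>s>0. \<phi> (l * s) \<le> e * \<phi> s)"
        using class_A0_small[OF \<phi>(1)] by metis
    next
      fix x :: 'a and R t :: real assume R: "0 < R" and t: "0 < t"
      define f where "f = bump \<phi> x R"
      have diff: "\<bar>f y - f z\<bar> \<le> \<phi> (dist y z)" for y z
        unfolding f_def
        using concave_on_imp_subadditive[OF \<phi>(2) \<phi>'(3)] by (intro abs_bump_diff_le[OF \<phi>'(2)])
      have "\<bar>f y - f z\<bar> \<le> \<phi> (dist y z) * (1 + 1)" for y z
        using diff[of y z] nonneg[of "dist y z"] by simp
      \<comment> \<open>The estimate holds for all pairs of points, so the exceptional set is
        empty.\<close>
      then have "(\<lambda>_. 1) \<in> hajlasz_gradients M \<phi> f"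
        unfolding hajlasz_gradients_def by (intro CollectI conjI bexI[of _ "{}"]) simp_all
      moreover have "f \<in> Lq_plus_Linf M p0"
        unfolding f_def using sets \<phi>' R p0 by (intro bump_Lq_plus_Linf) auto
      ultimately have "epowr (osc M (\<lambda>y. ennreal (\<bar>f y\<bar> powr p0)) t) (1 / p0)
          \<le> ennreal (C * \<phi> (the_inv_into {0..} v t)) *
            epowr (rearr_avg M (\<lambda>x. ennreal (1 powr p)) t) (1 / p)"
        using C(2) t by blast
      also have "\<dots> \<le> ennreal (C * \<phi> (the_inv_into {0..} v t)) * ennreal 1"
        using rearr_avg_le_bound[of 1 t M "\<lambda>x. ennreal (1 powr p)"] t
          epowr_le_ennreal_iff[OF assms(2), of 1] by (intro mult_left_mono) auto
      finally show "epowr (osc M (\<lambda>y. ennreal (\<bar>bump \<phi> x R y\<bar> powr p0)) t) (1 / p0)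
          \<le> ennreal (C * \<phi> (the_inv_into {0..} v t))"
        by (simp add: f_def)
    qed
  }
qed

end
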